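(* Let $f$ be a non zero holomorphic function (that is, not identically zero) defined on an open domain $U\subseteq\mathbb{C}$, and let $\gamma$ be a smooth Jordan curve lying inside $U$. Then for any line $L\subset\mathbb{C}$ passing through the origin there exist at least $2m+\lambda$ distinct points on $\gamma$ mapped to $L$ by $f$, where $m$ is the number of zeros of $f$ inside $\gamma$ and $\lambda$ is the number of zeros of $f$ on $\gamma$, all counted according to multiplicities.
   Context: A domain is a nonempty connected open subset of $\mathbb{C}$. A smooth Jordan curve is a simple closed curve in $\mathbb{C}$ that admits a continuously differentiable closed parametrization with nowhere vanishing derivative; $\gamma$ also denotes its image. "Inside $\gamma$" means in the bounded component of $\mathbb{C}\setminus\gamma$. A line passing through the origin is a one-dimensional real linear subspace of $\mathbb{C}\cong\mathbb{R}^2$. A point $z$ on $\gamma$ is mapped to $L$ by $f$ if $f(z)\in L$.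
   Formalization: The curve γ is required to lie in U together with its inside; with only γ in U the claim fails, e.g. U = ℂ∖{0}, f(z) = 1 − 1/(2z), γ the unit circle, L the imaginary axis, where m = 1 but no point of γ is mapped to L. *)

theory Defs
  imports "HOL-Complex_Analysis.Complex_Analysis"
begin

text \<open>
  A curve is identified with its image. The condition \<open>g' 0 = g' 1\<close> makes the parametrization
  continuously differentiable as a closed curve, i.e. also at the base point; without it a corner
  there would be admitted.
\<close>

definition smooth_Jordan_curve :: "complex set \<Rightarrow> bool" where
  "smooth_Jordan_curve \<gamma> \<longleftrightarrow>
     (\<exists>g g'. simple_path g \<and> pathfinish g = pathstart g \<and> path_image g = \<gamma> \<and>
        (\<forall>t\<in>{0..1}. (g has_vector_derivative g' t) (at t within {0..1})) \<and>
        continuous_on {0..1} g' \<and> g' 0 = g' 1 \<and> (\<forall>t\<in>{0..1}. g' t \<noteq> 0))"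

definition line_through_origin :: "complex set \<Rightarrow> bool" where
  "line_through_origin L \<longleftrightarrow> subspace L \<and> dim L = 1"

text \<open>
  Zeros are counted with multiplicity. The value is meaningful when \<open>f\<close> is holomorphic near
  each point of \<open>A\<close>, vanishes identically near none of them (so that \<open>zorder f z\<close> is the usual positive multiplicity
  at a zero) and has finitely many zeros in \<open>A\<close>. The lemma below provides the finiteness for a
  Jordan curve together with its inside.
\<close>

definition zeros_count :: "(complex \<Rightarrow> complex) \<Rightarrow> complex set \<Rightarrow> nat" where
  "zeros_count f A = (\<Sum>z | z \<in> A \<and> f z = 0. nat (zorder f z))"

lemma finite_zeros_smooth_Jordan_curve:
  assumes "open U" "connected U" "f holomorphic_on U" "\<exists>z\<in>U. f z \<noteq> 0"
    and "smooth_Jordan_curve \<gamma>" "\<gamma> \<union> inside \<gamma> \<subseteq> U"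
  shows "finite {z. z \<in> \<gamma> \<union> inside \<gamma> \<and> f z = 0}"
proof (cases "f constant_on U")
  case True
  then have "{z. z \<in> \<gamma> \<union> inside \<gamma> \<and> f z = 0} = {}"
    using assms(4,6) unfolding constant_on_def by fastforce
  then show ?thesis by (metis finite.emptyI)
next
  case False
  from assms(5) obtain g where g: "simple_path g" "path_image g = \<gamma>"
    unfolding smooth_Jordan_curve_def by blast
  then have "path g" by (simp add: simple_path_imp_path)
  with g have "compact \<gamma>" "closed (\<gamma> \<union> inside \<gamma>)"
    using compact_path_image closed_path_image_Un_inside by blast+
  moreover from this have "bounded (\<gamma> \<union> inside \<gamma>)"
    by (simp add: bounded_inside compact_imp_bounded)
  ultimately have "compact (\<gamma> \<union> inside \<gamma>)"
    by (simp add: compact_eq_bounded_closed)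
  from holomorphic_compact_finite_zeros[OF assms(3,1,2) this assms(6) False]
  show ?thesis by simp
qed

end

theory Submission
  imports Defs
begin

text \<open>
  The idea is to follow the argument of \<open>f\<close> along \<open>\<gamma>\<close> only modulo \<open>\<pi>\<close>. Membership of
  \<open>f z\<close> in a line through the origin depends on the argument modulo \<open>\<pi>\<close> alone, and modulo \<open>\<pi>\<close> the
  argument survives the passage through a zero on \<open>\<gamma>\<close>: if \<open>g\<close> parametrizes \<open>\<gamma>\<close> and \<open>a = g s\<close>, then
  \<open>g t - a = sin (\<pi> (t - s)) * \<phi> t\<close> with a real first factor and a continuous \<open>\<phi>\<close> without zeros, because
  \<open>g' s \<noteq> 0\<close>. Hence a continuous \<open>\<theta>\<close> on \<open>{0..1}\<close> exists such that \<open>f (g t)\<close> is always a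
  real multiple of \<open>exp (\<i> * \<theta> t)\<close>. If the total change of \<open>\<theta>\<close> is \<open>N * \<pi>\<close> in absolute value, the
  intermediate value theorem gives \<open>N\<close> parameters in \<open>{0..<1}\<close>, hence \<open>N\<close> distinct points of \<open>\<gamma>\<close>, at which
  \<open>\<theta>\<close> has the direction of the line modulo \<open>\<pi>\<close> (\<open>points_on_line_of_half_turns\<close>).

  To find \<open>N\<close>, write \<open>f z = (\<Prod>a. (z - a) ^ k a) * h z\<close>, the product over the zeros on and inside
  \<open>\<gamma>\<close>, with \<open>h\<close> free of zeros there (\<open>factor_out_zeros\<close>). Changes of argument add up over factors.
  Let \<open>\<sigma> = 1\<close> or \<open>\<sigma> = -1\<close> be the orientation of \<open>g\<close>. The factor \<open>h\<close>
  contributes nothing by Cauchy's theorem (\<open>half_turns_nonvanishing_inside\<close>), a zero inside contributes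
  \<open>2 * \<sigma>\<close> half turns since \<open>g\<close> has winding number \<open>\<sigma>\<close> about it, and a zero on
  \<open>\<gamma>\<close> contributes \<open>\<sigma>\<close> half turns: this is \<open>half_turns_chord\<close>, the heart of the proof.
  So \<open>N\<close> is twice the number of zeros inside plus the number of zeros on \<open>\<gamma>\<close>.

  For the last contribution, \<open>\<phi>\<close> is antiperiodic, so it makes an odd number of half turns. On the other hand
  \<open>\<phi>\<^sup>2\<close> can be compared with \<open>(g - p1) * (g - p2)\<close>, where \<open>p1\<close> and \<open>p2\<close> lie at small distance from \<open>a\<close> on the two
  sides of \<open>\<gamma>\<close> along the normal; so the number of half turns is the sum of the winding numbers
  about \<open>p1\<close> and \<open>p2\<close>, which is \<open>0\<close>, \<open>\<sigma>\<close> or \<open>2 * \<sigma>\<close>. Being odd, it is \<open>\<sigma>\<close>, whichever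
  of the two points is inside.
\<close>

section \<open>Arguments modulo half turns\<close>

text \<open>
  The real factor \<open>\<rho>\<close> may vanish and change sign; this is what lets \<open>Im q\<close>, the argument of \<open>u\<close>
  modulo \<open>\<pi>\<close>, run continuously through zeros of \<open>u\<close>. Such an \<open>n\<close> need not be unique: if
  \<open>u\<close> vanishes on an interval, \<open>q\<close> is arbitrary there.
\<close>
definition half_turns :: "(real \<Rightarrow> complex) \<Rightarrow> int \<Rightarrow> bool" where
  "half_turns u n \<longleftrightarrow>
     (\<exists>(\<rho>::real \<Rightarrow> real) q. continuous_on {0..1} q \<and>
        (\<forall>t\<in>{0..1}. u t = of_real (\<rho> t) * exp (q t)) \<and>
        q 1 - q 0 = of_int n * (of_real pi * \<i>))"

lemma half_turns_cong:
  assumes "half_turns u n" and "\<And>t. t \<in> {0..1} \<Longrightarrow> u t = w t"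
  shows "half_turns w n"
proof -
  obtain \<rho> q where "continuous_on {0..1} q" "\<forall>t\<in>{0..1}. u t = of_real (\<rho> t) * exp (q t)"
      "q 1 - q 0 = of_int n * (of_real pi * \<i>)"
    using assms(1) unfolding half_turns_def by blast
  then show ?thesis
    unfolding half_turns_def by (intro exI[of _ \<rho>] exI[of _ q]) (simp add: assms(2)[symmetric])
qed

lemma half_turns_one: "half_turns (\<lambda>_. 1) 0"
  unfolding half_turns_def
  by (rule exI[of _ "\<lambda>_. 1"], rule exI[of _ "\<lambda>_. 0"]) auto

lemma half_turns_mult:
  assumes "half_turns u m" and "half_turns w n"
  shows "half_turns (\<lambda>t. u t * w t) (m + n)"
proof -
  obtain \<rho> q where q: "continuous_on {0..1} q" "\<forall>t\<in>{0..1}. u t = of_real (\<rho> t) * exp (q t)"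
      "q 1 - q 0 = of_int m * (of_real pi * \<i>)"
    using assms(1) unfolding half_turns_def by blast
  obtain \<tau> r where r: "continuous_on {0..1} r" "\<forall>t\<in>{0..1}. w t = of_real (\<tau> t) * exp (r t)"
      "r 1 - r 0 = of_int n * (of_real pi * \<i>)"
    using assms(2) unfolding half_turns_def by blast
  have "continuous_on {0..1} (\<lambda>t. q t + r t)"
    by (intro continuous_intros q r)
  moreover have "\<forall>t\<in>{0..1}. u t * w t = of_real (\<rho> t * \<tau> t) * exp (q t + r t)"
    using q(2) r(2) by (simp add: exp_add)
  moreover have "(q 1 + r 1) - (q 0 + r 0) = of_int (m + n) * (of_real pi * \<i>)"
    using q(3) r(3) by (simp add: algebra_simps)
  ultimately show ?thesis
    unfolding half_turns_def
    by (intro exI[of _ "\<lambda>t. \<rho> t * \<tau> t"] exI[of _ "\<lambda>t. q t + r t"] conjI)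
qed

lemma half_turns_power:
  assumes "half_turns u n"
  shows "half_turns (\<lambda>t. u t ^ k) (int k * n)"
proof (induction k)
  case 0
  show ?case using half_turns_one by simp
next
  case (Suc k)
  show ?case using half_turns_mult[OF assms Suc] by (simp add: algebra_simps)
qed

lemma half_turns_prod:
  assumes "finite A" and "\<And>a. a \<in> A \<Longrightarrow> half_turns (u a) (n a)"
  shows "half_turns (\<lambda>t. \<Prod>a\<in>A. u a t) (\<Sum>a\<in>A. n a)"
  using assms
proof (induction rule: finite_induct)
  case empty
  show ?case using half_turns_one by simp
next
  case (insert a A)
  then show ?case using half_turns_mult[of "u a" "n a"] by simp
qed

lemma half_turns_winding_number:
  assumes "path p" and "z \<notin> path_image p" and "winding_number p z = of_int n"
  shows "half_turns (\<lambda>t. p t - z) (2 * n)"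
proof -
  obtain q where q: "path q"
      "pathfinish q - pathstart q = 2 * of_real pi * \<i> * winding_number p z"
      "\<And>t. t \<in> {0..1} \<Longrightarrow> p t = z + exp (q t)"
    using winding_number_as_continuous_log[OF assms(1,2)] by blast
  show ?thesis
    unfolding half_turns_def
  proof (intro exI[of _ "\<lambda>_. 1 :: real"] exI[of _ q] conjI)
    show "continuous_on {0..1} q" using q(1) by (simp add: path_def)
    show "\<forall>t\<in>{0..1}. p t - z = complex_of_real 1 * exp (q t)" using q(3) by simp
    show "q 1 - q 0 = of_int (2 * n) * (of_real pi * \<i>)"
      using q(2) assms(3) by (simp add: pathfinish_def pathstart_def)
  qed
qed

text \<open>
  A path in the right half-plane cannot wind about the origin: its argument would have to pass through
  the direction opposite to the one it started from.
\<close>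
lemma continuous_log_increment_zero:
  fixes q :: "real \<Rightarrow> complex"
  assumes "continuous_on {0..1} q" and "\<And>t. t \<in> {0..1} \<Longrightarrow> 0 < Re (exp (q t))"
    and "exp (q 1) = exp (q 0)"
  shows "q 1 = q 0"
proof -
  define x where "x t = Im (q t)" for t
  have cont: "continuous_on {0..1} x"
    unfolding x_def by (intro continuous_intros assms)
  have pos: "0 < cos (x t)" if "t \<in> {0..1}" for t
    using assms(2)[OF that] by (simp add: Re_exp x_def zero_less_mult_iff)
  have no_rotation: "x t \<noteq> x 0 + pi" "x t \<noteq> x 0 - pi" if "t \<in> {0..1}" for t
    using pos[OF that] pos[of 0] by (auto simp: cos_diff)
  obtain n :: int where n: "q 1 = q 0 + of_int (2 * n) * (of_real pi * \<i>)"
    using assms(3) exp_eq[of "q 1" "q 0"] by (auto simp: algebra_simps)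
  then have x1: "x 1 = x 0 + 2 * pi * of_int n"
    by (simp add: x_def)
  consider "n \<ge> 1" | "n \<le> -1" | "n = 0" by linarith
  then show ?thesis
  proof cases
    case 1
    then have "(2 * pi) * 1 \<le> 2 * pi * of_int n"
      by (intro mult_left_mono) auto
    then obtain t where "0 \<le> t" "t \<le> 1" "x t = x 0 + pi"
      using IVT'[of x 0 "x 0 + pi" 1] cont x1 pi_gt_zero by auto
    then show ?thesis using no_rotation by simp
  next
    case 2
    then have "2 * pi * of_int n \<le> (2 * pi) * (-1)"
      by (intro mult_left_mono) auto
    then obtain t where "0 \<le> t" "t \<le> 1" "x t = x 0 - pi"
      using IVT2'[of x 1 "x 0 - pi" 0] cont x1 pi_gt_zero by auto
    then show ?thesis using no_rotation by simp
  next
    case 3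
    then show ?thesis using n by simp
  qed
qed

section \<open>The argument of chords from a boundary point\<close>

lemma tendsto_difference_quotient_within:
  fixes u :: "real \<Rightarrow> complex"
  assumes "(u has_vector_derivative d) (at x within I)"
  shows "((\<lambda>y. (u y - u x) / of_real (y - x)) \<longlongrightarrow> d) (at x within I)"
proof -
  have "((\<lambda>y. (1 / norm (y - x)) *\<^sub>R (u y - (u x + (y - x) *\<^sub>R d))) \<longlongrightarrow> 0) (at x within I)"
    using assms by (simp add: has_vector_derivative_def has_derivative_within)
  then have "((\<lambda>y. norm ((1 / norm (y - x)) *\<^sub>R (u y - (u x + (y - x) *\<^sub>R d)))) \<longlongrightarrow> 0) (at x within I)"
    by (rule tendsto_norm_zero)
  moreover have "\<forall>\<^sub>F y in at x within I.
      norm ((1 / norm (y - x)) *\<^sub>R (u y - (u x + (y - x) *\<^sub>R d)))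
      = norm ((u y - u x) / of_real (y - x) - d)"
  proof (rule eventually_at_topological[THEN iffD2], intro exI[of _ UNIV] conjI ballI impI)
    fix y assume "y \<noteq> x"
    then have "(u y - u x) / of_real (y - x) - d
        = (u y - (u x + (y - x) *\<^sub>R d)) / of_real (y - x)"
      by (simp add: field_simps scaleR_conv_of_real)
    then show "norm ((1 / norm (y - x)) *\<^sub>R (u y - (u x + (y - x) *\<^sub>R d)))
        = norm ((u y - u x) / of_real (y - x) - d)"
      by (simp add: norm_divide flip: of_real_diff)
  qed auto
  ultimately have "((\<lambda>y. norm ((u y - u x) / of_real (y - x) - d)) \<longlongrightarrow> 0) (at x within I)"
    using tendsto_cong by fast
  then show ?thesis
    using LIM_zero_iff tendsto_norm_zero_iff by blast
qed

text \<open>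
  At a zero of \<open>v\<close> both functions are divided by \<open>y - x\<close>, as in the rule of l'Hopital. The zeros of
  \<open>v\<close> are simple, hence isolated, so the filled function is \<open>u / v\<close> near, but off, each of them.
\<close>
lemma continuous_on_filled_quotient:
  fixes u u' :: "real \<Rightarrow> complex" and v v' :: "real \<Rightarrow> real"
  assumes u: "\<And>t. t \<in> I \<Longrightarrow> (u has_vector_derivative u' t) (at t within I)"
    and v: "\<And>t. t \<in> I \<Longrightarrow> (v has_real_derivative v' t) (at t within I)"
    and zero: "\<And>t. t \<in> I \<Longrightarrow> v t = 0 \<Longrightarrow> u t = 0 \<and> v' t \<noteq> 0"
  shows "continuous_on I (\<lambda>t. if v t = 0 then u' t / of_real (v' t) else u t / of_real (v t))"
    (is "continuous_on I ?w")
  unfolding continuous_on_def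
proof
  fix x assume x: "x \<in> I"
  have contu: "(u \<longlongrightarrow> u x) (at x within I)"
    using has_vector_derivative_continuous[OF u[OF x]] by (simp add: continuous_within)
  have contv: "(v \<longlongrightarrow> v x) (at x within I)"
    using DERIV_continuous[OF v[OF x]] by (simp add: continuous_within)
  show "(?w \<longlongrightarrow> ?w x) (at x within I)"
  proof (cases "v x = 0")
    case False
    have "\<forall>\<^sub>F y in at x within I. v y \<noteq> 0"
      using tendsto_imp_eventually_ne[OF contv False] .
    then have "\<forall>\<^sub>F y in at x within I. u y / of_real (v y) = ?w y"
      by eventually_elim simp
    moreover have "((\<lambda>y. u y / of_real (v y)) \<longlongrightarrow> u x / of_real (v x)) (at x within I)"
      using False by (intro tendsto_intros contu contv) simp
    ultimately have "(?w \<longlongrightarrow> u x / of_real (v x)) (at x within I)"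
      using tendsto_cong by fast
    then show ?thesis using False by simp
  next
    case True
    then have ux: "u x = 0" and v'x: "v' x \<noteq> 0" using zero x by auto
    have qu: "((\<lambda>y. u y / of_real (y - x)) \<longlongrightarrow> u' x) (at x within I)"
      using tendsto_difference_quotient_within[OF u[OF x]] ux by simp
    have qv: "((\<lambda>y. v y / (y - x)) \<longlongrightarrow> v' x) (at x within I)"
      using v[OF x] True by (simp add: has_field_derivative_iff)
    have "\<forall>\<^sub>F y in at x within I. v y / (y - x) \<noteq> 0"
      using tendsto_imp_eventually_ne[OF qv v'x] .
    then have "\<forall>\<^sub>F y in at x within I.
        (u y / of_real (y - x)) / of_real (v y / (y - x)) = ?w y"
      by eventually_elim auto
    moreover have "((\<lambda>y. (u y / of_real (y - x)) / of_real (v y / (y - x)))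
        \<longlongrightarrow> u' x / of_real (v' x)) (at x within I)"
      using v'x by (intro tendsto_divide tendsto_of_real qu qv) simp
    ultimately have "(?w \<longlongrightarrow> u' x / of_real (v' x)) (at x within I)"
      using tendsto_cong by fast
    then show ?thesis using True by simp
  qed
qed

text \<open>
  A smooth curve looks straight near \<open>g s\<close>, so the chord from \<open>g s\<close> sweeps half of the angle that it
  would sweep from a point inside. The proof replaces the local picture by a comparison of \<open>(g t - g s)\<^sup>2\<close>
  with \<open>(g t - p1) * (g t - p2) = (g t - g s)\<^sup>2 + \<epsilon>\<^sup>2 * (g' s)\<^sup>2\<close>, where \<open>p1\<close> and \<open>p2\<close> are
  \<open>g s\<close> shifted by \<open>\<epsilon> * \<i> * g' s\<close> in the two normal directions, and by a parity argument.
\<close>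
lemma half_turns_chord:
  fixes \<sigma> :: int
  assumes simple: "simple_path g" and loop: "pathfinish g = pathstart g"
    and deriv: "\<And>t. t \<in> {0..1} \<Longrightarrow> (g has_vector_derivative g' t) (at t within {0..1})"
    and g': "g' 0 = g' 1" "\<And>t. t \<in> {0..1} \<Longrightarrow> g' t \<noteq> 0"
    and \<sigma>: "\<bar>\<sigma>\<bar> = 1" "\<And>z. z \<in> inside (path_image g) \<Longrightarrow> winding_number g z = of_int \<sigma>"
    and s: "s \<in> {0..<1}"
  shows "half_turns (\<lambda>t. g t - g s) \<sigma>"
proof -
  \<comment> \<open>On \<open>{0..1}\<close> the sine vanishes just where \<open>g t = g s\<close>, which is at both ends if \<open>s = 0\<close>, and it
     has opposite values at the two ends. The latter makes \<open>\<phi>\<close> antiperiodic.\<close>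
  define v where "v t = sin (pi * (t - s))" for t
  define v' where "v' t = pi * cos (pi * (t - s))" for t
  define \<phi> where "\<phi> t = (if v t = 0 then g' t / of_real (v' t) else (g t - g s) / of_real (v t))" for t
  have ends: "g 1 = g 0" using loop by (simp add: pathfinish_def pathstart_def)
  have v_zero: "t = s \<or> s = 0 \<and> t = 1" if t: "t \<in> {0..1}" "v t = 0" for t
  proof -
    obtain i :: int where "pi * (t - s) = of_int i * pi"
      using t(2) sin_zero_iff_int2[of "pi * (t - s)"] by (auto simp: v_def)
    then have i: "t - s = of_int i" by simp
    then have "-1 < real_of_int i" "real_of_int i \<le> 1" using t(1) s by auto
    then have "i = 0 \<or> i = 1" by linarith
    then show ?thesis using i t(1) s by auto
  qed
  have g_eq: "t = s \<or> s = 0 \<and> t = 1" if "t \<in> {0..1}" "g t = g s" for t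
  proof -
    have "t = s \<or> t = 0 \<and> s = 1 \<or> t = 1 \<and> s = 0"
      using simple that s unfolding simple_path_def loop_free_def
      by (meson atLeastAtMost_iff atLeastLessThan_iff less_imp_le)
    then show ?thesis using s by auto
  qed
  have v'_nz: "v' t \<noteq> 0" if "v t = 0" for t
    using that sin_cos_squared_add[of "pi * (t - s)"] by (auto simp: v_def v'_def)
  have chord: "g t - g s = of_real (v t) * \<phi> t" if "t \<in> {0..1}" for t
    using v_zero[OF that] ends by (auto simp: \<phi>_def)
  have \<phi>_nz: "\<phi> t \<noteq> 0" if "t \<in> {0..1}" for t
  proof (cases "v t = 0")
    case True
    then show ?thesis using v'_nz g'(2)[OF that] by (simp add: \<phi>_def)
  next
    case False
    then have "g t \<noteq> g s" using g_eq[OF that] by (auto simp: v_def)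
    then show ?thesis using False by (simp add: \<phi>_def)
  qed
  have cont: "continuous_on {0..1} \<phi>"
    unfolding \<phi>_def
  proof (rule continuous_on_filled_quotient)
    show "((\<lambda>t. g t - g s) has_vector_derivative g' t) (at t within {0..1})" if "t \<in> {0..1}" for t
      using has_vector_derivative_diff[OF deriv[OF that] has_vector_derivative_const] by simp
    show "(v has_real_derivative v' t) (at t within {0..1})" for t
      unfolding v_def v'_def by (auto intro!: derivative_eq_intros)
    show "g t - g s = 0 \<and> v' t \<noteq> 0" if "t \<in> {0..1}" "v t = 0" for t
      using v_zero[OF that] v'_nz[OF that(2)] ends by auto
  qed
  have v1: "v 1 = - v 0" and v'1: "v' 1 = - v' 0"
    by (simp_all add: v_def v'_def sin_diff cos_diff right_diff_distrib)
  have antiperiodic: "\<phi> 1 = - \<phi> 0"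
    using ends g'(1) by (auto simp: \<phi>_def v1 v'1)

  \<comment> \<open>\<open>(g t - p1) * (g t - p2) / (\<phi> t)\<^sup>2 = (v t)\<^sup>2 + \<epsilon>\<^sup>2 * W t\<close>. The number \<open>\<epsilon>\<close> has to keep this in the right half-plane
     for all \<open>t\<close>: near the zeros of \<open>v\<close> the term with \<open>W\<close> has positive real part, and on the compact
     set \<open>K\<close> where it has not, \<open>(v t)\<^sup>2\<close> has a positive minimum that dominates it.\<close>
  define W where "W t = (g' s / \<phi> t)\<^sup>2" for t
  have contW: "continuous_on {0..1} W"
    unfolding W_def by (intro continuous_intros cont) (use \<phi>_nz in auto)
  have W_pos: "0 < Re (W t)" if t: "t \<in> {0..1}" "v t = 0" for t
  proof -
    have "g' t = g' s" using v_zero[OF t] g'(1) by auto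
    then have "\<phi> t = g' s / of_real (v' t)" using t(2) by (simp add: \<phi>_def)
    then have "W t = of_real ((v' t)\<^sup>2)"
      using g'(2)[of s] s by (simp add: W_def)
    then show ?thesis using v'_nz[OF t(2)] by simp
  qed
  define K where "K = {t \<in> {0..1}. Re (W t) \<le> 0}"
  have "compact K"
  proof -
    have "closed ({0..1} \<inter> (\<lambda>t. Re (W t)) -` {..0})"
      by (intro continuous_closed_preimage continuous_intros contW)
    moreover have "{0..1} \<inter> (\<lambda>t. Re (W t)) -` {..0} = K" by (auto simp: K_def)
    moreover have "bounded K" by (rule bounded_subset[of "{0..1}"]) (auto simp: K_def)
    ultimately show ?thesis by (simp add: compact_eq_bounded_closed)
  qed
  obtain \<delta> where \<delta>: "\<delta> > 0" "\<And>t. t \<in> K \<Longrightarrow> \<delta> \<le> (v t)\<^sup>2"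
  proof (cases "K = {}")
    case True
    then show ?thesis using that[of 1] by auto
  next
    case False
    have "continuous_on K (\<lambda>t. (v t)\<^sup>2)" unfolding v_def by (intro continuous_intros)
    then obtain x where x: "x \<in> K" "\<forall>t\<in>K. (v x)\<^sup>2 \<le> (v t)\<^sup>2"
      using continuous_attains_inf[OF \<open>compact K\<close> False] by blast
    have "v x \<noteq> 0" using W_pos x(1) by (force simp: K_def)
    then show ?thesis using that[of "(v x)\<^sup>2"] x(2) by simp
  qed
  have "bounded (W ` {0..1})"
    by (intro compact_imp_bounded compact_continuous_image contW) auto
  then obtain M where M: "M > 0" "\<And>t. t \<in> {0..1} \<Longrightarrow> norm (W t) \<le> M"
    by (auto simp: bounded_pos)
  define \<epsilon> where "\<epsilon> = sqrt (\<delta> / (M + 1))"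
  have \<epsilon>2: "\<epsilon>\<^sup>2 = \<delta> / (M + 1)" and \<epsilon>: "\<epsilon> > 0" using \<delta>(1) M(1) by (auto simp: \<epsilon>_def)
  define R where "R t = of_real ((v t)\<^sup>2) + of_real (\<epsilon>\<^sup>2) * W t" for t
  have R_pos: "0 < Re (R t)" if t: "t \<in> {0..1}" for t
  proof (cases "t \<in> K")
    case True
    have "- M \<le> Re (W t)" using abs_Re_le_cmod[of "W t"] M(2)[OF t] by linarith
    then have "\<epsilon>\<^sup>2 * (- M) \<le> \<epsilon>\<^sup>2 * Re (W t)" by (intro mult_left_mono) auto
    moreover have "\<epsilon>\<^sup>2 * M < \<delta>" using \<delta>(1) M(1) by (simp add: \<epsilon>2 field_simps)
    ultimately show ?thesis using \<delta>(2)[OF True] by (simp add: R_def)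
  next
    case False
    then have "0 < \<epsilon>\<^sup>2 * Re (W t)" using t \<epsilon> by (auto simp: K_def)
    then show ?thesis by (simp add: R_def add_nonneg_pos)
  qed
  define p1 where "p1 = g s + \<i> * of_real \<epsilon> * g' s"
  define p2 where "p2 = g s - \<i> * of_real \<epsilon> * g' s"
  have product: "(g t - p1) * (g t - p2) = (\<phi> t)\<^sup>2 * R t" if t: "t \<in> {0..1}" for t
  proof -
    have "(g t - p1) * (g t - p2) = (g t - g s)\<^sup>2 - (\<i> * of_real \<epsilon> * g' s)\<^sup>2"
      unfolding p1_def p2_def by (simp add: power2_eq_square algebra_simps)
    also have "\<dots> = (of_real (v t) * \<phi> t)\<^sup>2 + of_real (\<epsilon>\<^sup>2) * (g' s)\<^sup>2"
      by (simp add: chord[OF t] power_mult_distrib)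
    also have "(g' s)\<^sup>2 = (\<phi> t)\<^sup>2 * W t"
      using \<phi>_nz[OF t] by (simp add: W_def power_divide)
    finally show ?thesis by (simp add: R_def power_mult_distrib algebra_simps)
  qed
  have off: "g t \<noteq> p1" "g t \<noteq> p2" if t: "t \<in> {0..1}" for t
    using product[OF t] R_pos[OF t] \<phi>_nz[OF t] by auto
  have path: "path g" using simple by (rule simple_path_imp_path)
  have off': "p1 \<notin> path_image g" "p2 \<notin> path_image g"
    using off unfolding path_image_def by blast+
  have wind: "winding_number g z \<in> {0, of_int \<sigma>}" if "z \<notin> path_image g" for z
    using \<sigma>(2) winding_number_zero_in_outside[OF path loop] that
      inside_Un_outside[of "path_image g"] by blast
  obtain q1 where q1: "path q1"
      "pathfinish q1 - pathstart q1 = 2 * of_real pi * \<i> * winding_number g p1"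
      "\<And>t. t \<in> {0..1} \<Longrightarrow> g t = p1 + exp (q1 t)"
    using winding_number_as_continuous_log[OF path off'(1)] by blast
  obtain q2 where q2: "path q2"
      "pathfinish q2 - pathstart q2 = 2 * of_real pi * \<i> * winding_number g p2"
      "\<And>t. t \<in> {0..1} \<Longrightarrow> g t = p2 + exp (q2 t)"
    using winding_number_as_continuous_log[OF path off'(2)] by blast
  have "path \<phi>" using cont by (simp add: path_def)
  moreover have "0 \<notin> path_image \<phi>" using \<phi>_nz unfolding path_image_def by force
  ultimately obtain q where q: "path q" "\<And>t. t \<in> {0..1} \<Longrightarrow> \<phi> t = exp (q t)"
    using winding_number_as_continuous_log[of \<phi> 0] by (metis add_0)
  \<comment> \<open>a logarithm of the ratio \<open>R\<close>; as \<open>R\<close> is a loop in the right half-plane, \<open>d\<close> returns to its initial value\<close>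
  define d where "d t = q1 t + q2 t - 2 * q t" for t
  have exp_d: "exp (d t) = R t" if t: "t \<in> {0..1}" for t
  proof -
    have "exp (q1 t) = g t - p1" "exp (q2 t) = g t - p2"
      using q1(3)[OF t] q2(3)[OF t] by (metis add_diff_cancel_left')+
    then have "exp (d t) * (\<phi> t)\<^sup>2 = (g t - p1) * (g t - p2)"
      using q(2)[OF t] by (simp add: d_def exp_diff exp_add exp_double)
    then show ?thesis using product[OF t] \<phi>_nz[OF t] by simp
  qed
  have "d 1 = d 0"
  proof (rule continuous_log_increment_zero)
    show "continuous_on {0..1} d"
      unfolding d_def using q1(1) q2(1) q(1) by (intro continuous_intros) (auto simp: path_def)
    show "0 < Re (exp (d t))" if "t \<in> {0..1}" for t
      using exp_d[OF that] R_pos[OF that] by simp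
    have "R 1 = R 0" by (simp add: R_def W_def v1 antiperiodic power_divide)
    then show "exp (d 1) = exp (d 0)" using exp_d by simp
  qed
  then have "2 * (q 1 - q 0) = (q1 1 - q1 0) + (q2 1 - q2 0)"
    by (simp add: d_def algebra_simps)
  also have "\<dots> = 2 * ((winding_number g p1 + winding_number g p2) * (of_real pi * \<i>))"
    using q1(2) q2(2) by (simp add: pathfinish_def pathstart_def algebra_simps)
  finally have turn: "q 1 - q 0 = (winding_number g p1 + winding_number g p2) * (of_real pi * \<i>)"
    by (subst (asm) mult_cancel_left) simp
  \<comment> \<open>The number of half turns is odd, which leaves \<open>\<sigma>\<close> among the sums \<open>0\<close>, \<open>\<sigma>\<close>, \<open>2 * \<sigma>\<close>.\<close>
  have "exp (q 1 - q 0) = -1"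
    using antiperiodic q(2)[of 0] q(2)[of 1] by (simp add: exp_diff)
  then have odd_turn: "q 1 - q 0 \<noteq> of_int (2 * n) * (of_real pi * \<i>)" for n
    using exp_eq_1[of "q 1 - q 0"] by (auto simp: complex_eq_iff)
  have "q 1 - q 0 = of_int \<sigma> * (of_real pi * \<i>)"
    using wind[OF off'(1)] wind[OF off'(2)] turn odd_turn[of 0] odd_turn[of \<sigma>] by auto
  then show ?thesis
    unfolding half_turns_def
    using q(1) q(2) chord by (intro exI[of _ v] exI[of _ q]) (simp add: path_def)
qed

section \<open>Removing the zeros\<close>

text \<open>
  Dividing by the product leaves removable singularities at the points of \<open>Z\<close>; the value to put at \<open>a\<close> is
  read off from the local factor \<open>zor_poly f a\<close>, which is not zero at \<open>a\<close>. A point of \<open>Z\<close> that is not a zero of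
  \<open>f\<close> has exponent \<open>0\<close>.
\<close>
lemma factor_out_zeros:
  assumes U: "open U" "connected U" and hol: "f holomorphic_on U" and nz: "\<exists>z\<in>U. f z \<noteq> 0"
    and Z: "finite Z" "Z \<subseteq> U"
  obtains h where "h holomorphic_on U" "\<And>a. a \<in> Z \<Longrightarrow> h a \<noteq> 0"
    "\<And>z. z \<in> U \<Longrightarrow> f z = (\<Prod>a\<in>Z. (z - a) ^ nat (zorder f a)) * h z"
proof -
  define P where "P A z = (\<Prod>a\<in>A. (z - a) ^ nat (zorder f a))" for A z
  define h where "h z = (if z \<in> Z then zor_poly f z z / P (Z - {z}) z else f z / P Z z)" for z
  have P_nz: "P A z \<noteq> 0" if "finite A" "z \<notin> A" for A z
    using that by (auto simp: P_def)
  have P_hol: "P A holomorphic_on S" for A S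
    unfolding P_def by (intro holomorphic_intros)
  have local: "\<exists>r>0. cball a r \<subseteq> U \<and> zor_poly f a holomorphic_on cball a r \<and>
      (\<forall>w\<in>cball a r. f w = zor_poly f a w * (w - a) ^ nat (zorder f a) \<and> zor_poly f a w \<noteq> 0)"
    if "a \<in> Z" for a
    using zorder_exist_zero[OF hol U, of a] nz that Z by blast
  have nonzero: "h a \<noteq> 0" if a: "a \<in> Z" for a
  proof -
    have "zor_poly f a a \<noteq> 0" using local[OF a] by (metis centre_in_cball less_imp_le)
    then show ?thesis using a P_nz[of "Z - {a}" a] Z by (simp add: h_def)
  qed
  have "h holomorphic_on U"
  proof (rule no_isolated_singularity')
    show "open U" "finite Z" by fact+
    have "(\<lambda>z. f z / P Z z) holomorphic_on U - Z"
      using hol P_hol P_nz Z by (intro holomorphic_intros) (auto intro: holomorphic_on_subset)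
    then show "h holomorphic_on U - Z"
      by (rule holomorphic_transform) (simp add: h_def)
    show "(h \<longlongrightarrow> h a) (at a within U)" if a: "a \<in> Z" for a
    proof -
      obtain r where r: "r > 0" "cball a r \<subseteq> U" "zor_poly f a holomorphic_on cball a r"
          "\<forall>w\<in>cball a r. f w = zor_poly f a w * (w - a) ^ nat (zorder f a) \<and> zor_poly f a w \<noteq> 0"
        using local[OF a] by blast
      have "isCont (\<lambda>w. zor_poly f a w / P (Z - {a}) w) a"
      proof (intro continuous_intros)
        show "isCont (zor_poly f a) a"
          using holomorphic_on_imp_continuous_on[OF r(3)] r(1)
            continuous_on_interior[of "cball a r" "zor_poly f a" a] by simp
        show "isCont (P (Z - {a})) a"
          using holomorphic_on_imp_continuous_on[OF P_hol[of _ UNIV]]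
          by (simp add: continuous_on_eq_continuous_at)
        show "P (Z - {a}) a \<noteq> 0" using P_nz Z by simp
      qed
      then have lim: "((\<lambda>w. zor_poly f a w / P (Z - {a}) w) \<longlongrightarrow> h a) (at a)"
        using a by (simp add: isCont_def h_def)
      have "open (ball a r - (Z - {a}))"
        using Z by (intro open_Diff finite_imp_closed) auto
      then have "\<forall>\<^sub>F w in at a. w \<in> ball a r - (Z - {a}) - {a}"
        by (rule eventually_at_in_open) (use r(1) in auto)
      then have "\<forall>\<^sub>F w in at a. zor_poly f a w / P (Z - {a}) w = h w"
      proof eventually_elim
        case (elim w)
        have "P Z w = (w - a) ^ nat (zorder f a) * P (Z - {a}) w"
          unfolding P_def using Z a by (simp add: prod.remove)
        moreover have "f w = zor_poly f a w * (w - a) ^ nat (zorder f a)"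
          using r(4) elim by auto
        ultimately show ?case using elim by (simp add: h_def)
      qed
      then have "(h \<longlongrightarrow> h a) (at a)" using lim tendsto_cong by fast
      then show ?thesis by (rule tendsto_within_subset) simp
    qed
  qed
  moreover have "f z = P Z z * h z" if "z \<in> U" for z
  proof (cases "z \<in> Z")
    case True
    obtain r where "r > 0" "\<forall>w\<in>cball z r. f w = zor_poly f z w * (w - z) ^ nat (zorder f z)"
      using local[OF True] by blast
    then have "f z = zor_poly f z z * (z - z) ^ nat (zorder f z)" by simp
    moreover have "P Z z = (z - z) ^ nat (zorder f z) * P (Z - {z}) z"
      unfolding P_def using Z True by (simp add: prod.remove)
    moreover have "P (Z - {z}) z \<noteq> 0" using P_nz Z by simp
    ultimately show ?thesis using True by (simp add: h_def)
  next
    case False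
    then show ?thesis using P_nz Z by (simp add: h_def)
  qed
  ultimately show thesis using that[OF _ nonzero] by (simp add: P_def)
qed

lemma valid_path_C1:
  assumes "\<And>t. t \<in> {0..1} \<Longrightarrow> (g has_vector_derivative g' t) (at t within {0..1})"
    and "continuous_on {0..1} g'"
  shows "valid_path g"
  unfolding valid_path_def piecewise_C1_differentiable_on_def C1_differentiable_on_def
proof (intro conjI exI[of _ "{0, 1 :: real}"] exI[of _ g'] ballI)
  show "continuous_on {0..1} g"
    using has_vector_derivative_continuous[OF assms(1)]
    by (simp add: continuous_on_eq_continuous_within)
  show "continuous_on ({0..1} - {0, 1}) g'"
    using assms(2) by (rule continuous_on_subset) auto
  fix t :: real assume "t \<in> {0..1} - {0, 1}"
  then have "t \<in> {0<..<1}" by auto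
  then show "(g has_vector_derivative g' t) (at t)"
    using assms(1)[of t] at_within_interior[of t "{0..1}"] by simp
qed simp

text \<open>
  The winding number of \<open>h \<circ> g\<close> about \<open>0\<close> is, up to the factor \<open>2 * \<pi> * \<i>\<close>, the integral of \<open>deriv h / h\<close> along \<open>g\<close>. It
  vanishes by the global form of Cauchy's theorem, as the integrand is holomorphic on a neighbourhood of
  the curve together with its inside.
\<close>
lemma half_turns_nonvanishing_inside:
  assumes g: "valid_path g" "pathfinish g = pathstart g"
    and h: "h holomorphic_on U" "open U" "path_image g \<union> inside (path_image g) \<subseteq> U"
    and nz: "\<And>z. z \<in> path_image g \<union> inside (path_image g) \<Longrightarrow> h z \<noteq> 0"
  shows "half_turns (\<lambda>t. h (g t)) 0"
proof -
  define V where "V = {z \<in> U. h z \<noteq> 0}"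
  have "open V"
  proof -
    have "open (U \<inter> h -` (- {0}))"
      using holomorphic_on_imp_continuous_on[OF h(1)] h(2)
      by (intro continuous_open_preimage) auto
    moreover have "U \<inter> h -` (- {0}) = V" by (auto simp: V_def)
    ultimately show ?thesis by simp
  qed
  have sub: "path_image g \<union> inside (path_image g) \<subseteq> V" using h(3) nz by (auto simp: V_def)
  have hV: "h holomorphic_on V" using h(1) by (rule holomorphic_on_subset) (auto simp: V_def)
  have "((\<lambda>w. deriv h w * (1 / (h w - 0))) has_contour_integral 0) g"
  proof (rule Cauchy_theorem_global_outside)
    show "(\<lambda>w. deriv h w * (1 / (h w - 0))) holomorphic_on V"
      using hV \<open>open V\<close> by (intro holomorphic_intros) (auto simp: V_def)
    show "w \<in> outside (path_image g)" if "w \<notin> V" for w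
      using that sub inside_Un_outside[of "path_image g"] by blast
  qed (use g sub \<open>open V\<close> in auto)
  then have "contour_integral g (\<lambda>w. deriv h w * (1 / (h w - 0))) = 0"
    by (rule contour_integral_unique)
  then have "contour_integral (h \<circ> g) (\<lambda>w. 1 / (w - 0)) = 0"
    using contour_integral_comp_analyticW[of h V g "\<lambda>w. 1 / (w - 0)"] hV \<open>open V\<close> sub g(1)
    by (simp add: analytic_on_open)
  moreover have valid: "valid_path (h \<circ> g)"
    using valid_path_compose_holomorphic[OF g(1) hV \<open>open V\<close>] sub by simp
  moreover have off: "0 \<notin> path_image (h \<circ> g)" using nz by (auto simp: path_image_def)
  ultimately have "winding_number (h \<circ> g) 0 = of_int 0"
    by (simp add: winding_number_valid_path)
  from half_turns_winding_number[OF valid_path_imp_path[OF valid] off this]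
  show ?thesis by simp
qed

section \<open>Counting points on the line\<close>

text \<open>
  The \<open>N\<close> numbers congruent to \<open>\<alpha>\<close> modulo \<open>\<pi>\<close> that lie in \<open>{\<theta> 0..<\<theta> 0 + N * pi}\<close> are all
  attained if \<open>\<theta>\<close> increases in total; otherwise negate \<open>\<theta>\<close>. Excluding the right end excludes the
  parameter \<open>1\<close>, so that on a closed curve no point is counted twice.
\<close>
lemma points_congruent_mod_pi:
  fixes \<theta> :: "real \<Rightarrow> real" and N :: nat
  assumes cont: "continuous_on {0..1} \<theta>" and N: "\<bar>\<theta> 1 - \<theta> 0\<bar> = of_nat N * pi"
  shows "\<exists>T. T \<subseteq> {0..<1} \<and> finite T \<and> card T = N \<and> (\<forall>t\<in>T. \<exists>k::int. \<theta> t = \<alpha> + of_int k * pi)"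
proof -
  have increasing: "\<exists>T. T \<subseteq> {0..<1} \<and> finite T \<and> card T = N \<and>
      (\<forall>t\<in>T. \<exists>k::int. \<theta> t = \<alpha> + of_int k * pi)"
    if cont: "continuous_on {0..1} \<theta>" and N: "\<theta> 1 - \<theta> 0 = of_nat N * pi"
    for \<theta> :: "real \<Rightarrow> real" and \<alpha>
  proof -
    \<comment> \<open>\<open>\<alpha> + k0 * pi\<close> is the first number of the residue class that is at least \<open>\<theta> 0\<close>.\<close>
    define k0 where "k0 = \<lceil>(\<theta> 0 - \<alpha>) / pi\<rceil>"
    define v where "v j = \<alpha> + of_int (k0 + int j) * pi" for j
    have "\<exists>t. t \<in> {0..<1} \<and> \<theta> t = v j" if j: "j < N" for j
    proof -
      have "(\<theta> 0 - \<alpha>) / pi \<le> of_int k0" "of_int k0 - 1 < (\<theta> 0 - \<alpha>) / pi"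
        unfolding k0_def by linarith+
      then have "\<theta> 0 - \<alpha> \<le> of_int k0 * pi" "(of_int k0 - 1) * pi < \<theta> 0 - \<alpha>"
        by (simp_all only: pos_divide_le_eq[OF pi_gt_zero] pos_less_divide_eq[OF pi_gt_zero])
      then have lo: "\<theta> 0 \<le> \<alpha> + of_int k0 * pi" and hi: "\<alpha> + of_int k0 * pi < \<theta> 0 + pi"
        by (simp_all only: left_diff_distrib mult_1)
      have "(of_nat j + 1) * pi \<le> of_nat N * pi"
        using j by (intro mult_right_mono) auto
      then have "of_nat j * pi + pi \<le> of_nat N * pi" by (simp add: algebra_simps)
      moreover have "v j = \<alpha> + of_int k0 * pi + of_nat j * pi"
        by (simp add: v_def algebra_simps)
      moreover have "0 \<le> real j * pi" by (intro mult_nonneg_nonneg) auto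
      ultimately have "\<theta> 0 \<le> v j" "v j < \<theta> 1"
        using lo hi N by linarith+
      then obtain t where t: "0 \<le> t" "t \<le> 1" "\<theta> t = v j"
        using IVT'[of \<theta> 0 "v j" 1] cont by auto
      with \<open>v j < \<theta> 1\<close> have "t \<noteq> 1" by auto
      with t show ?thesis by auto
    qed
    then obtain t where t: "\<And>j. j < N \<Longrightarrow> t j \<in> {0..<1} \<and> \<theta> (t j) = v j" by metis
    have "inj_on t {..<N}"
    proof (rule inj_onI)
      fix i j assume "i \<in> {..<N}" "j \<in> {..<N}" "t i = t j"
      then have "v i = v j" using t by (metis lessThan_iff)
      then show "i = j" by (simp add: v_def)
    qed
    then have "card (t ` {..<N}) = N" by (simp add: card_image)
    moreover have "t ` {..<N} \<subseteq> {0..<1}" using t by auto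
    moreover have "\<exists>k::int. \<theta> x = \<alpha> + of_int k * pi" if x: "x \<in> t ` {..<N}" for x
    proof -
      obtain j where "j < N" "x = t j" using x by auto
      then have "\<theta> x = v j" using t by simp
      then show ?thesis unfolding v_def by (rule exI)
    qed
    ultimately show ?thesis
      by (intro exI[of _ "t ` {..<N}"] conjI ballI finite_imageI finite_lessThan)
  qed
  consider "\<theta> 1 - \<theta> 0 = of_nat N * pi" | "- \<theta> 1 - - \<theta> 0 = of_nat N * pi"
    using N by linarith
  then show ?thesis
  proof cases
    case 1
    then show ?thesis by (rule increasing[OF cont])
  next
    case 2
    have "continuous_on {0..1} (\<lambda>t. - \<theta> t)" by (intro continuous_intros cont)
    from increasing[OF this 2, of "- \<alpha>"] obtain T where
      T: "T \<subseteq> {0..<1}" "finite T" "card T = N" "\<forall>t\<in>T. \<exists>k::int. - \<theta> t = - \<alpha> + of_int k * pi"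
      by blast
    have "\<exists>k::int. \<theta> t = \<alpha> + of_int k * pi" if t: "t \<in> T" for t
    proof -
      obtain k :: int where "- \<theta> t = - \<alpha> + of_int k * pi" using bspec[OF T(4) t] by (rule exE)
      then show ?thesis by (intro exI[of _ "- k"]) (simp add: algebra_simps)
    qed
    with T(1-3) show ?thesis by (intro exI[of _ T] conjI ballI)
  qed
qed

text \<open>
  The line consists of the real multiples of \<open>cis \<alpha>\<close>, and \<open>f (g t)\<close> is such a multiple as soon as
  the argument \<open>Im (q t)\<close> is congruent to \<open>\<alpha>\<close> modulo \<open>\<pi>\<close>.
\<close>
lemma points_on_line_of_half_turns:
  assumes simple: "simple_path g" and turns: "half_turns (\<lambda>t. f (g t)) n"
    and L: "line_through_origin L"
  shows "\<exists>S. S \<subseteq> path_image g \<and> finite S \<and> card S = nat \<bar>n\<bar> \<and> (\<forall>z\<in>S. f z \<in> L)"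
proof -
  have L': "subspace L" "dim L = 1" using L by (auto simp: line_through_origin_def)
  then have "\<not> L \<subseteq> {0}" using dim_subset[of L "{0}"] by auto
  then obtain w where w: "w \<in> L" "w \<noteq> 0" by blast
  define \<alpha> where "\<alpha> = Arg w"
  have line: "of_real r * cis \<alpha> \<in> L" for r
  proof -
    have "of_real r * cis \<alpha> = (r / norm w) *\<^sub>R w"
      using w(2) cis_Arg[of w] by (simp add: \<alpha>_def sgn_eq scaleR_conv_of_real field_simps)
    then show ?thesis using L'(1) w(1) by (simp add: subspace_scale)
  qed
  obtain \<rho> q where q: "continuous_on {0..1} q"
      "\<forall>t\<in>{0..1}. f (g t) = of_real (\<rho> t) * exp (q t)"
      "q 1 - q 0 = of_int n * (of_real pi * \<i>)"
    using turns unfolding half_turns_def by blast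
  have "Im (q 1) - Im (q 0) = of_int n * pi" using arg_cong[OF q(3), of Im] by simp
  then have "\<bar>Im (q 1) - Im (q 0)\<bar> = of_nat (nat \<bar>n\<bar>) * pi"
    by (simp add: abs_mult)
  moreover have "continuous_on {0..1} (\<lambda>t. Im (q t))" by (intro continuous_intros q)
  ultimately obtain T where T: "T \<subseteq> {0..<1}" "finite T" "card T = nat \<bar>n\<bar>"
      "\<forall>t\<in>T. \<exists>k::int. Im (q t) = \<alpha> + of_int k * pi"
    using points_congruent_mod_pi[of "\<lambda>t. Im (q t)" "nat \<bar>n\<bar>" \<alpha>] by blast
  show ?thesis
  proof (intro exI[of _ "g ` T"] conjI ballI)
    show "g ` T \<subseteq> path_image g" using T(1) by (auto simp: path_image_def)
    show "finite (g ` T)" using T(2) by simp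
    have "inj_on g T"
    proof (rule inj_onI)
      fix x y assume "x \<in> T" "y \<in> T" "g x = g y"
      moreover from this have "x \<in> {0..<1}" "y \<in> {0..<1}" using T(1) by auto
      ultimately show "x = y"
        using simple unfolding simple_path_def loop_free_def by fastforce
    qed
    then show "card (g ` T) = nat \<bar>n\<bar>" using T(3) by (simp add: card_image)
    fix z assume "z \<in> g ` T"
    then obtain t where t: "t \<in> T" "z = g t" by blast
    then obtain k :: int where k: "Im (q t) = \<alpha> + of_int k * pi" using T(4) by blast
    have "cis (of_int k * pi) = of_real (cos (of_int k * pi))"
      by (simp add: complex_eq_iff sin_zero_iff_int2)
    then have "exp (q t) = of_real (exp (Re (q t)) * cos (of_int k * pi)) * cis \<alpha>"
      by (simp add: exp_eq_polar k cis_mult[symmetric])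
    moreover have "t \<in> {0..1}" using t(1) T(1) by auto
    ultimately have "f z = of_real (\<rho> t * (exp (Re (q t)) * cos (of_int k * pi))) * cis \<alpha>"
      using q(2) t(2) by simp
    then show "f z \<in> L" by (simp only: line)
  qed
qed

section \<open>Points mapped to a line\<close>

theorem theorem2:
  fixes f :: "complex \<Rightarrow> complex" and U \<gamma> L :: "complex set"
  assumes "open U" and "connected U" and "U \<noteq> {}"
    and "f holomorphic_on U" and "\<exists>z\<in>U. f z \<noteq> 0"
    and "smooth_Jordan_curve \<gamma>" and "\<gamma> \<subseteq> U" and "inside \<gamma> \<subseteq> U"
    and "line_through_origin L"
  shows "\<exists>S. S \<subseteq> \<gamma> \<and> finite S \<and> (\<forall>z\<in>S. f z \<in> L) \<and>
           card S \<ge> 2 * zeros_count f (inside \<gamma>) + zeros_count f \<gamma>"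
proof -
  obtain g g' where g: "simple_path g" "pathfinish g = pathstart g" "path_image g = \<gamma>"
      "\<And>t. t \<in> {0..1} \<Longrightarrow> (g has_vector_derivative g' t) (at t within {0..1})"
      "continuous_on {0..1} g'" "g' 0 = g' 1" "\<And>t. t \<in> {0..1} \<Longrightarrow> g' t \<noteq> 0"
    using assms(6) unfolding smooth_Jordan_curve_def by blast
  have path: "path g" using g(1) by (rule simple_path_imp_path)
  obtain \<sigma> :: int where \<sigma>: "\<bar>\<sigma>\<bar> = 1"
      "\<And>z. z \<in> inside \<gamma> \<Longrightarrow> winding_number g z = of_int \<sigma>"
    using simple_closed_path_winding_number_inside[OF g(1)] g(3)
    by (metis abs_1 abs_minus_cancel of_int_1 of_int_minus)
  define Zi where "Zi = {z. z \<in> inside \<gamma> \<and> f z = 0}"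
  define Zb where "Zb = {z. z \<in> \<gamma> \<and> f z = 0}"
  define k where "k z = nat (zorder f z)" for z
  define turns where "turns z = (if z \<in> \<gamma> then \<sigma> else 2 * \<sigma>)" for z
  have "finite {z. z \<in> \<gamma> \<union> inside \<gamma> \<and> f z = 0}"
    using assms by (intro finite_zeros_smooth_Jordan_curve[of U]) auto
  then have fin: "finite Zi" "finite Zb"
    by (auto simp: Zi_def Zb_def elim: finite_subset[rotated])
  have off: "a \<notin> \<gamma>" if "a \<in> inside \<gamma>" for a using that inside_no_overlap[of \<gamma>] by blast
  have disj: "Zi \<inter> Zb = {}" using off by (auto simp: Zi_def Zb_def)
  obtain h where h: "h holomorphic_on U" "\<And>a. a \<in> Zi \<union> Zb \<Longrightarrow> h a \<noteq> 0"
      "\<And>z. z \<in> U \<Longrightarrow> f z = (\<Prod>a\<in>Zi \<union> Zb. (z - a) ^ k a) * h z"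
    using factor_out_zeros[OF assms(1,2,4,5), of "Zi \<union> Zb"] fin assms(7,8)
    unfolding k_def Zi_def Zb_def by blast
  have "half_turns (\<lambda>t. g t - a) (turns a)" if a: "a \<in> Zi \<union> Zb" for a
  proof (cases "a \<in> \<gamma>")
    case True
    then obtain s0 where s0: "s0 \<in> {0..1}" "a = g s0" using g(3) by (auto simp: path_image_def)
    \<comment> \<open>The base point is both \<open>g 0\<close> and \<open>g 1\<close>; the chord lemma takes it at parameter \<open>0\<close>.\<close>
    define s where "s = (if s0 = 1 then 0 else s0)"
    have s: "s \<in> {0..<1}" "a = g s"
      using s0 g(2) by (auto simp: s_def pathfinish_def pathstart_def)
    have "half_turns (\<lambda>t. g t - g s) \<sigma>"
      using g \<sigma> s(1) by (intro half_turns_chord[of g g']) auto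
    then show ?thesis using True s(2) by (simp add: turns_def)
  next
    case False
    then have "winding_number g a = of_int \<sigma>" using a \<sigma>(2) by (auto simp: Zi_def Zb_def)
    then show ?thesis
      using half_turns_winding_number[OF path, of a \<sigma>] False g(3) by (simp add: turns_def)
  qed
  then have "half_turns (\<lambda>t. \<Prod>a\<in>Zi \<union> Zb. (g t - a) ^ k a) (\<Sum>a\<in>Zi \<union> Zb. int (k a) * turns a)"
    using fin by (intro half_turns_prod half_turns_power) auto
  moreover have "half_turns (\<lambda>t. h (g t)) 0"
  proof (rule half_turns_nonvanishing_inside[where g = g and h = h and U = U])
    show "h z \<noteq> 0" if "z \<in> path_image g \<union> inside (path_image g)" for z
      using that h(2)[of z] h(3)[of z] assms(7,8) g(3) by (fastforce simp: Zi_def Zb_def)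
  qed (use g h(1) assms(1,7,8) valid_path_C1[OF g(4,5)] in auto)
  ultimately have product: "half_turns (\<lambda>t. (\<Prod>a\<in>Zi \<union> Zb. (g t - a) ^ k a) * h (g t))
      ((\<Sum>a\<in>Zi \<union> Zb. int (k a) * turns a) + 0)"
    by (rule half_turns_mult)
  have total: "(\<Sum>a\<in>Zi \<union> Zb. int (k a) * turns a)
      = \<sigma> * int (2 * zeros_count f (inside \<gamma>) + zeros_count f \<gamma>)"
  proof -
    have "(\<Sum>a\<in>Zi. int (k a) * turns a) = (\<Sum>a\<in>Zi. 2 * \<sigma> * int (k a))"
      using off by (intro sum.cong) (auto simp: Zi_def turns_def)
    moreover have "(\<Sum>a\<in>Zb. int (k a) * turns a) = (\<Sum>a\<in>Zb. \<sigma> * int (k a))"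
      by (intro sum.cong) (auto simp: Zb_def turns_def)
    ultimately show ?thesis
      using sum.union_disjoint[OF fin disj, of "\<lambda>a. int (k a) * turns a"]
      by (simp add: zeros_count_def flip: Zi_def Zb_def k_def)
        (simp add: sum_distrib_left algebra_simps)
  qed
  have "half_turns (\<lambda>t. f (g t)) (\<sigma> * int (2 * zeros_count f (inside \<gamma>) + zeros_count f \<gamma>))"
  proof (rule half_turns_cong[OF product[unfolded add_0_right total]])
    fix t :: real assume "t \<in> {0..1}"
    then have "g t \<in> U" using assms(7) g(3) by (auto simp: path_image_def)
    then show "(\<Prod>a\<in>Zi \<union> Zb. (g t - a) ^ k a) * h (g t) = f (g t)" by (simp add: h(3))
  qed
  then obtain S where S: "S \<subseteq> path_image g" "finite S"
      "card S = nat \<bar>\<sigma> * int (2 * zeros_count f (inside \<gamma>) + zeros_count f \<gamma>)\<bar>"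
      "\<forall>z\<in>S. f z \<in> L"
    using points_on_line_of_half_turns[where f = f, OF g(1) _ assms(9)] by metis
  have "card S = 2 * zeros_count f (inside \<gamma>) + zeros_count f \<gamma>"
    using S(3) by (simp only: abs_mult \<sigma>(1) mult_1 abs_of_nat nat_int)
  then show ?thesis using S(1,2,4) g(3) by (intro exI[of _ S]) simp
qed

end
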